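(* Let $a<b$ be real numbers. There exist a Lebesgue integrable, essentially unbounded exponent $p:[a,b]\to[1,+\infty)$ and a function $f\in WBV_{p(\cdot)}[a,b]$ such that the right-hand limit $f(a+)$ does not exist.
   Context: For a nondegenerate closed interval $Q=[s,t]\subset[a,b]$ put $f(Q):=f(t)-f(s)$, $|Q|=t-s$, and $\bar p(Q):=\left(\frac{1}{|Q|}\int_Q\frac{1}{p(x)}\,dx\right)^{-1}$. A finite partition of $[a,b]$ is a family $P=\{Q_k\}_{k=1}^n$ with $Q_k=[t_{k-1},t_k]$ and $a=t_0<\dots<t_n=b$; $\Pi[a,b]$ is the set of all finite partitions. Define $$V_a^b(p,f):=\sup_{P\in\Pi[a,b]}\sum_{k=1}^n|f(Q_k)|^{\bar p(Q_k)}\in[0,+\infty],$$ $$\|f\|_{WBV_{p(\cdot)}}:=\inf\{\lambda>0: V_a^b(p,f/\lambda)\le 1\}\quad(\inf\emptyset=+\infty),$$ $$WBV_{p(\cdot)}[a,b]:=\{f:[a,b]\to\mathbb{R}: f(a)=0,\ \|f\|_{WBV_{p(\cdot)}}<+\infty\}.$$ "Essentially unbounded" means not essentially bounded, i.e. $\operatorname{ess\,sup} p=+\infty$. *)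

theory Defs
  imports "HOL-Analysis.Analysis" "HOL-Probability.Essential_Supremum"
begin

text \<open>
  Functions on \<open>[a,b]\<close> are represented by functions on all of \<open>real\<close>; every notion below
  depends only on their values on \<open>[a,b]\<close>.
\<close>

definition exponent_on :: "real \<Rightarrow> real \<Rightarrow> (real \<Rightarrow> real) \<Rightarrow> bool" where
  "exponent_on a b p \<longleftrightarrow> p \<in> borel_measurable (lebesgue_on {a..b}) \<and> (\<forall>x\<in>{a..b}. 1 \<le> p x)"

text \<open>
  The library's essential supremum is \<open>top\<close> for non-measurable functions; it is only meant to be
  applied to measurable exponents here.
\<close>

definition essentially_unbounded_on :: "real \<Rightarrow> real \<Rightarrow> (real \<Rightarrow> real) \<Rightarrow> bool" where
  "essentially_unbounded_on a b p \<longleftrightarrow> esssup (lebesgue_on {a..b}) (\<lambda>x. ereal (p x)) = \<infinity>"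

definition mean_exponent :: "(real \<Rightarrow> real) \<Rightarrow> real \<Rightarrow> real \<Rightarrow> real" where
  "mean_exponent p s t = inverse (1 / (t - s) * (LINT x:{s..t}|lebesgue. 1 / p x))"

text \<open>A pair \<open>(n, t)\<close> encodes the partition with nodes \<open>a = t 0 < \<dots> < t n = b\<close>;
  the values of \<open>t\<close> beyond \<open>n\<close> are irrelevant.\<close>

definition partitions :: "real \<Rightarrow> real \<Rightarrow> (nat \<times> (nat \<Rightarrow> real)) set" where
  "partitions a b = {(n, t). t 0 = a \<and> t n = b \<and> strict_mono_on {0..n} t}"

definition wvariation :: "real \<Rightarrow> real \<Rightarrow> (real \<Rightarrow> real) \<Rightarrow> (real \<Rightarrow> real) \<Rightarrow> ennreal" where
  "wvariation a b p f =
     (SUP (n, t) \<in> partitions a b.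
        \<Sum>k=1..n. ennreal (\<bar>f (t k) - f (t (k - 1))\<bar> powr mean_exponent p (t (k - 1)) (t k)))"

definition wbv_norm :: "real \<Rightarrow> real \<Rightarrow> (real \<Rightarrow> real) \<Rightarrow> (real \<Rightarrow> real) \<Rightarrow> ennreal" where
  "wbv_norm a b p f = Inf {ennreal l | l. 0 < l \<and> wvariation a b p (\<lambda>x. f x / l) \<le> 1}"

definition WBV :: "real \<Rightarrow> real \<Rightarrow> (real \<Rightarrow> real) \<Rightarrow> (real \<Rightarrow> real) set" where
  "WBV a b p = {f. f a = 0 \<and> wbv_norm a b p f < \<infinity>}"

end

theory Submission
  imports Defs "HOL-Real_Asymp.Real_Asymp"
begin

text \<open>
  The exponent given by \<open>p x = sqrt ((b - a) / (x - a))\<close> for \<open>x > a\<close> and \<open>p a = 1\<close> is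
  integrable, decreases on \<open>(a,b]\<close>, and tends to infinity at \<open>a+\<close>. The function \<open>f\<close> is \<open>1\<close> where the integer part of \<open>p\<close> is even and
  \<open>0\<close> where it is odd, so it jumps between \<open>0\<close> and \<open>1\<close> infinitely often near \<open>a\<close>,
  and \<open>f(a+)\<close> does not exist.

  The variation of \<open>f/2\<close> is nevertheless at most \<open>1\<close> (\<open>wvariation_parity_le_1\<close>).
  Only intervals on which \<open>f/2\<close> has increment \<open>1/2\<close> in absolute value contribute. Since
  \<open>p\<close> decreases on \<open>(a,b]\<close>, its harmonic mean over \<open>[s,t]\<close> is at least its right endpoint value
  \<open>p t\<close> (\<open>mean_exponent_ge\<close>), hence at least the integer part of \<open>p t\<close>. If \<open>f\<close>
  changes across two intervals of a partition, the integer part of \<open>p\<close> drops strictly between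
  their right endpoints. The contributing intervals therefore have distinct positive integer
  parts \<open>i\<close>, each contributes at most \<open>(1/2)^i\<close>, and these bounds add up to at most
  \<open>1/2 + 1/4 + \<dots> = 1\<close>.
\<close>

text \<open>
  A pointwise lower bound on \<open>p\<close> bounds the average of \<open>1/p\<close> from above. Because inversion
  sends \<open>0\<close> to \<open>0\<close>, it reverses this inequality only once the average is known to be
  positive. The bound is asked for on the open interval, so that it can be applied to intervals
  that start at a singularity of \<open>p\<close>, where the value of \<open>p\<close> says nothing about its
  neighbours.
\<close>
lemma mean_exponent_ge:
  assumes "s < t" and p: "exponent_on s t p" and "0 < c"
    and ge: "\<And>x. x \<in> {s<..<t} \<Longrightarrow> c \<le> p x"
  shows "c \<le> mean_exponent p s t"
proof -
  let ?M = "lebesgue_on {s..t}"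
  have fin: "finite_measure ?M"
    by (intro finite_measure_lebesgue_on) simp
  have p1: "1 \<le> p x" if "x \<in> {s..t}" for x
    using p that by (simp add: exponent_on_def)
  have [measurable]: "p \<in> borel_measurable ?M"
    using p by (simp add: exponent_on_def)
  have int: "integrable ?M (\<lambda>x. 1 / p x)"
  proof (rule finite_measure.integrable_const_bound[OF fin, where B = 1])
    show "AE x in ?M. norm (1 / p x) \<le> 1"
    proof (rule AE_I2)
      fix x assume "x \<in> space ?M"
      then have "1 \<le> p x" by (intro p1) simp
      then show "norm (1 / p x) \<le> 1" by simp
    qed
  qed measurable
  have len: "measure ?M {s..t} = t - s"
    using \<open>s < t\<close> by (simp add: measure_restrict_space)
  have pos: "0 < integral\<^sup>L ?M (\<lambda>x. 1 / p x)"
  proof -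
    have "integral\<^sup>L ?M (\<lambda>x. 0) < integral\<^sup>L ?M (\<lambda>x. 1 / p x)"
    proof (rule finite_measure.integral_less_AE_space[OF fin _ int])
      show "AE x in ?M. 0 < 1 / p x"
        using p1 by (intro AE_I2) (force intro: less_le_trans[OF zero_less_one])
      show "emeasure ?M (space ?M) \<noteq> 0"
        using \<open>s < t\<close> by (simp add: emeasure_restrict_space)
    qed simp
    then show ?thesis by simp
  qed
  have "integral\<^sup>L ?M (\<lambda>x. 1 / p x) \<le> integral\<^sup>L ?M (\<lambda>x. 1 / c)"
  proof (rule integral_mono_AE[OF int])
    show "integrable ?M (\<lambda>x. 1 / c)"
      by (rule finite_measure.integrable_const[OF fin])
    have "AE x in lebesgue. x \<notin> {s, t}"
      by (intro AE_not_in) auto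
    then have "AE x in lebesgue. x \<in> {s..t} \<longrightarrow> 1 / p x \<le> 1 / c"
    proof eventually_elim
      case (elim x)
      then show ?case
        using ge[of x] \<open>0 < c\<close> by (auto intro!: divide_left_mono)
    qed
    then show "AE x in ?M. 1 / p x \<le> 1 / c"
      by (simp add: AE_restrict_space_iff)
  qed
  also have "\<dots> = (t - s) / c"
    using len by simp
  finally have "1 / (t - s) * integral\<^sup>L ?M (\<lambda>x. 1 / p x) \<le> 1 / c"
    using \<open>s < t\<close> \<open>0 < c\<close> by (simp add: field_simps)
  moreover have "0 < 1 / (t - s) * integral\<^sup>L ?M (\<lambda>x. 1 / p x)"
    using \<open>s < t\<close> pos by simp
  moreover have "(LINT x:{s..t}|lebesgue. 1 / p x) = integral\<^sup>L ?M (\<lambda>x. 1 / p x)"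
    by (simp add: set_lebesgue_integral_def integral_restrict_space)
  ultimately show ?thesis
    using le_imp_inverse_le[of "1 / (t - s) * integral\<^sup>L ?M (\<lambda>x. 1 / p x)" "1 / c"]
    by (simp add: mean_exponent_def)
qed

text \<open>
  The faster \<open>p\<close> grows towards \<open>a\<close>, the more often the parity changes, but each change then
  carries a larger exponent: the oscillation is paid for by the exponent that drives it.
\<close>
lemma wvariation_parity_le_1:
  assumes p: "exponent_on a b p"
    and anti: "antimono_on {a<..b} p"
  shows "wvariation a b p (\<lambda>x. of_bool (even \<lfloor>p x\<rfloor>) / 2) \<le> 1"
  unfolding wvariation_def
proof (rule SUP_least, clarify)
  fix n t assume "(n, t) \<in> partitions a b"
  then have t0: "t 0 = a" and tn: "t n = b" and mono: "strict_mono_on {0..n} t"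
    by (auto simp: partitions_def)
  define f where "f = (\<lambda>x. of_bool (even \<lfloor>p x\<rfloor>) / 2 :: real)"
  \<comment> \<open>One less than the integer part, to match the series \<open>\<Sum>j. (1/2) ^ Suc j = 1\<close>.\<close>
  define m where "m k = nat (\<lfloor>p (t k)\<rfloor> - 1)" for k
  define J where "J = {k \<in> {1..n}. f (t k) \<noteq> f (t (k - 1))}"
  have less: "t i < t j" if "i < j" "j \<le> n" for i j
    using strict_mono_onD[OF mono, of i j] that by simp
  have in_ab: "t k \<in> {a<..b}" if "1 \<le> k" "k \<le> n" for k
    using less[of 0 k] less[of k n] t0 tn that by (cases "k = n") auto
  have p1: "1 \<le> p x" if "x \<in> {a..b}" for x
    using p that by (simp add: exponent_on_def)
  have p_anti: "p (t j) \<le> p (t i)" if "1 \<le> i" "i \<le> j" "j \<le> n" for i j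
    using monotone_onD[OF anti in_ab[of i] in_ab[of j]] less[of i j] that
    by (cases "i = j") auto
  have floor1: "1 \<le> \<lfloor>p (t k)\<rfloor>" and m_le: "real (Suc (m k)) \<le> p (t k)" if "k \<in> {1..n}" for k
  proof -
    have "1 \<le> p (t k)" using p1[of "t k"] in_ab[of k] that by auto
    then show "1 \<le> \<lfloor>p (t k)\<rfloor>" "real (Suc (m k)) \<le> p (t k)"
      unfolding m_def by linarith+
  qed
  \<comment> \<open>The right endpoint of interval \<open>i\<close> is at or left of the left endpoint of interval
    \<open>j\<close>, and the integer part changes, hence drops, across interval \<open>j\<close>. Both endpoints of
    interval \<open>j\<close> lie right of \<open>a\<close>, where \<open>p\<close> is monotone, since \<open>j\<close> is not the first interval.\<close>
  have m_less: "m j < m i" if "i \<in> J" "j \<in> J" "i < j" for i j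
  proof -
    have ij: "1 \<le> i" "i \<le> j - 1" "j \<le> n" using that by (auto simp: J_def)
    have "p (t j) \<le> p (t (j - 1))" "p (t (j - 1)) \<le> p (t i)"
      using ij by (auto intro: p_anti)
    then have "\<lfloor>p (t j)\<rfloor> \<le> \<lfloor>p (t (j - 1))\<rfloor>" and "\<lfloor>p (t (j - 1))\<rfloor> \<le> \<lfloor>p (t i)\<rfloor>"
      by (auto intro: floor_mono)
    moreover have "\<lfloor>p (t j)\<rfloor> \<noteq> \<lfloor>p (t (j - 1))\<rfloor>"
      using that by (auto simp: J_def f_def)
    ultimately have "\<lfloor>p (t j)\<rfloor> < \<lfloor>p (t i)\<rfloor>" by linarith
    moreover have "1 \<le> \<lfloor>p (t j)\<rfloor>"
      using that by (intro floor1) (simp add: J_def)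
    ultimately show ?thesis
      unfolding m_def by linarith
  qed
  have inj: "inj_on m J"
    by (rule linorder_inj_onI') (use m_less in fastforce)
  have term_le: "ennreal (\<bar>f (t k) - f (t (k - 1))\<bar> powr mean_exponent p (t (k - 1)) (t k))
      \<le> (if k \<in> J then ennreal ((1 / 2) ^ Suc (m k)) else 0)" if k: "k \<in> {1..n}" for k
  proof (cases "k \<in> J")
    case True
    have tk: "t (k - 1) < t k" and sub: "a \<le> t (k - 1)" "t k \<le> b"
      using less[of "k - 1" k] less[of 0 "k - 1"] in_ab[of k] t0 k by (cases "k = 1"; force)+
    have "p (t k) \<le> mean_exponent p (t (k - 1)) (t k)"
    proof (rule mean_exponent_ge[OF tk])
      have "{t (k - 1)..t k} \<subseteq> {a..b}" using sub by auto
      then show "exponent_on (t (k - 1)) (t k) p"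
        using p unfolding exponent_on_def
        by (auto intro: measurable_restrict_mono)
      show "0 < p (t k)" using p1[of "t k"] in_ab[of k] k by auto
      show "p (t k) \<le> p x" if "x \<in> {t (k - 1)<..<t k}" for x
        using that sub by (intro monotone_onD[OF anti]) auto
    qed
    then have "real (Suc (m k)) \<le> mean_exponent p (t (k - 1)) (t k)"
      using m_le[OF k] by linarith
    then have "(1 / 2) powr mean_exponent p (t (k - 1)) (t k) \<le> (1 / 2 :: real) ^ Suc (m k)"
      by (subst powr_realpow[symmetric]) (auto intro!: powr_mono')
    moreover have "\<bar>f (t k) - f (t (k - 1))\<bar> = 1 / 2"
      using True by (auto simp: J_def f_def of_bool_def split: if_splits)
    ultimately show ?thesis
      using True by (simp only: if_True ennreal_leI)
  next
    case False
    then show ?thesis using k by (simp add: J_def)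
  qed
  have "(\<Sum>k=1..n. ennreal (\<bar>f (t k) - f (t (k - 1))\<bar> powr mean_exponent p (t (k - 1)) (t k)))
      \<le> (\<Sum>k=1..n. if k \<in> J then ennreal ((1 / 2) ^ Suc (m k)) else 0)"
    by (rule sum_mono) (rule term_le)
  also have "\<dots> = (\<Sum>k\<in>J. ennreal ((1 / 2) ^ Suc (m k)))"
    by (simp add: J_def sum.inter_filter[symmetric])
  also have "\<dots> = ennreal (\<Sum>j\<in>m ` J. (1 / 2) ^ Suc j)"
    by (subst sum_ennreal) (simp_all add: sum.reindex[OF inj])
  also have "\<dots> \<le> ennreal (\<Sum>j. (1 / 2) ^ Suc j)"
    by (intro ennreal_leI sum_le_suminf sums_summable[OF power_half_series]) (auto simp: J_def)
  also have "\<dots> = 1"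
    using sums_unique[OF power_half_series] by simp
  finally show "(\<Sum>k=1..n. ennreal
      (\<bar>of_bool (even \<lfloor>p (t k)\<rfloor>) / 2 - of_bool (even \<lfloor>p (t (k - 1))\<rfloor>) / 2\<bar>
        powr mean_exponent p (t (k - 1)) (t k))) \<le> 1"
    by (simp add: f_def)
qed

text \<open>
  If the essential supremum were a finite \<open>C\<close>, the interval to the right of \<open>a\<close> on which
  \<open>p\<close> exceeds \<open>C\<close> would be a null set.
\<close>
lemma essentially_unbounded_onI:
  assumes "a < b" and p: "exponent_on a b p" and lim: "filterlim p at_top (at_right a)"
  shows "essentially_unbounded_on a b p"
  unfolding essentially_unbounded_on_def
proof (rule ccontr)
  let ?M = "lebesgue_on {a..b}"
  assume "esssup ?M (\<lambda>x. ereal (p x)) \<noteq> \<infinity>"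
  then obtain C where C: "esssup ?M (\<lambda>x. ereal (p x)) \<le> ereal C"
    by (cases "esssup ?M (\<lambda>x. ereal (p x))") auto
  have [measurable]: "p \<in> borel_measurable ?M"
    using p by (simp add: exponent_on_def)
  have "AE x in ?M. ereal (p x) \<le> esssup ?M (\<lambda>x. ereal (p x))"
    by (rule esssup_AE)
  then have "AE x in ?M. p x \<le> C"
  proof eventually_elim
    case (elim x)
    then show ?case using order_trans[OF elim C] by simp
  qed
  then have ae: "AE x in lebesgue. x \<in> {a..b} \<longrightarrow> p x \<le> C"
    by (simp add: AE_restrict_space_iff)
  have "eventually (\<lambda>x. C < p x) (at_right a)"
    using lim by (simp add: filterlim_at_top_dense)
  then obtain d where d: "a < d" "\<And>x. a < x \<Longrightarrow> x < d \<Longrightarrow> C < p x"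
    by (auto simp: eventually_at_right_field)
  from ae have "AE x in lebesgue. x \<notin> {a<..<min b d}"
  proof eventually_elim
    case (elim x)
    then show ?case using d(2)[of x] by auto
  qed
  then have "emeasure lebesgue {a<..<min b d} = 0"
    by (subst (asm) AE_iff_measurable[where N = "{a<..<min b d}"]) auto
  then show False
    using \<open>a < b\<close> d(1) by simp
qed

lemma integrable_inverse_sqrt:
  fixes a b :: real
  assumes "a \<le> b"
  shows "integrable (lebesgue_on {a..b}) (\<lambda>x. 1 / sqrt (x - a))"
proof -
  have "((\<lambda>x. 1 / sqrt (x - a)) has_integral 2 * sqrt (b - a) - 2 * sqrt (a - a)) {a..b}"
  proof (rule fundamental_theorem_of_calculus_interior[OF assms])
    show "continuous_on {a..b} (\<lambda>x. 2 * sqrt (x - a))"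
      by (intro continuous_intros)
    show "((\<lambda>x. 2 * sqrt (x - a)) has_vector_derivative 1 / sqrt (x - a)) (at x)"
      if "x \<in> {a<..<b}" for x
      using that unfolding has_real_derivative_iff_has_vector_derivative[symmetric]
      by (auto intro!: derivative_eq_intros simp: field_simps)
  qed
  then have "(\<lambda>x. 1 / sqrt (x - a)) absolutely_integrable_on {a..b}"
    by (intro nonnegative_absolutely_integrable_1) (auto simp: has_integral_integrable)
  then show ?thesis
    by (simp add: absolutely_integrable_on_def set_integrable_def integrable_restrict_space)
qed

lemma no_limit_if_alternating:
  fixes f :: "real \<Rightarrow> real"
  assumes x: "filterlim x (at_right a) sequentially"
    and f: "eventually (\<lambda>n. f (x n) = of_bool (even n)) sequentially"
  shows "\<not> (f \<longlongrightarrow> L) (at_right a)"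
proof
  assume "(f \<longlongrightarrow> L) (at_right a)"
  then have "(\<lambda>n. f (x n)) \<longlonglongrightarrow> L"
    using x by (rule filterlim_compose)
  then have lim: "(\<lambda>n. of_bool (even n) :: real) \<longlonglongrightarrow> L"
    using f by (rule Lim_transform_eventually)
  have "(\<lambda>n. of_bool (even (2 * n)) :: real) \<longlonglongrightarrow> L"
    using LIMSEQ_subseq_LIMSEQ[OF lim, of "\<lambda>n. 2 * n"] by (simp add: strict_mono_def o_def)
  moreover have "(\<lambda>n. of_bool (even (2 * n + 1)) :: real) \<longlonglongrightarrow> L"
    using LIMSEQ_subseq_LIMSEQ[OF lim, of "\<lambda>n. 2 * n + 1"] by (simp add: strict_mono_def o_def)
  ultimately show False
    by (simp add: LIMSEQ_const_iff)
qed

theorem theorem2p9: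
  fixes a b :: real
  assumes "a < b"
  shows "\<exists>p f :: real \<Rightarrow> real.
           exponent_on a b p \<and> integrable (lebesgue_on {a..b}) p \<and> essentially_unbounded_on a b p \<and>
           f \<in> WBV a b p \<and> \<not> (\<exists>L. (f \<longlongrightarrow> L) (at_right a))"
proof -
  \<comment> \<open>The value \<open>p a = 1\<close> keeps the exponent at least \<open>1\<close>, and being odd it gives \<open>f a = 0\<close>.\<close>
  define p where "p x = (if x = a then 1 else sqrt (b - a) * (1 / sqrt (x - a)))" for x
  define f where "f x = (of_bool (even \<lfloor>p x\<rfloor>) :: real)" for x
  have int: "integrable (lebesgue_on {a..b}) p"
  proof (rule integrable_cong_AE_imp)
    show "integrable (lebesgue_on {a..b}) (\<lambda>x. sqrt (b - a) * (1 / sqrt (x - a)))"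
      using integrable_inverse_sqrt[of a b] assms by (intro integrable_mult_right) simp
    have "AE x in lebesgue. x \<notin> {a}"
      by (intro AE_not_in) auto
    then have "AE x in lebesgue. x \<in> {a..b} \<longrightarrow> sqrt (b - a) * (1 / sqrt (x - a)) = p x"
      by eventually_elim (simp add: p_def)
    then show "AE x in lebesgue_on {a..b}. sqrt (b - a) * (1 / sqrt (x - a)) = p x"
      by (simp add: AE_restrict_space_iff)
    show "p \<in> borel_measurable (lebesgue_on {a..b})"
      unfolding p_def by (intro measurable_restrict_space1 measurable_completion) measurable
  qed
  have exp: "exponent_on a b p"
    using assms int by (auto simp: exponent_on_def p_def borel_measurable_integrable)
  have "filterlim (\<lambda>x. sqrt (b - a) * (1 / sqrt (x - a))) at_top (at_right a)"
    using assms by real_asymp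
  moreover have "eventually (\<lambda>x. sqrt (b - a) * (1 / sqrt (x - a)) = p x) (at_right a)"
    unfolding p_def by (auto simp: eventually_at_filter)
  ultimately have "filterlim p at_top (at_right a)"
    by (rule filterlim_cong[OF refl refl, THEN iffD1, rotated])
  then have unb: "essentially_unbounded_on a b p"
    by (rule essentially_unbounded_onI[OF assms exp])
  have "antimono_on {a<..b} p"
    using assms by (auto simp: monotone_on_def p_def intro!: divide_left_mono)
  then have "wvariation a b p (\<lambda>x. f x / 2) \<le> 1"
    unfolding f_def by (rule wvariation_parity_le_1[OF exp])
  then have "wbv_norm a b p f \<le> ennreal 2"
    unfolding wbv_norm_def by (intro Inf_lower CollectI exI[of _ 2]) (rule conjI[OF refl], simp)
  then have wbv: "f \<in> WBV a b p"
    by (auto simp: WBV_def f_def p_def intro: le_less_trans)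
  \<comment> \<open>Chosen such that \<open>p (x n) = n\<close> for \<open>n > 0\<close>.\<close>
  define x where "x n = a + (b - a) / (real n)\<^sup>2" for n
  have "\<not> (f \<longlongrightarrow> L) (at_right a)" for L
  proof (rule no_limit_if_alternating)
    show "filterlim x (at_right a) sequentially"
      using assms unfolding x_def by real_asymp
    have "f (x n) = of_bool (even n)" if "n > 0" for n
      using that assms by (simp add: f_def p_def x_def real_sqrt_divide)
    then show "eventually (\<lambda>n. f (x n) = of_bool (even n)) sequentially"
      using eventually_gt_at_top[of 0] by (rule eventually_mono[rotated])
  qed
  then show ?thesis
    using exp int unb wbv by blast
qed

end
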